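(* Any commutative post-Lie algebra structure on the twisted Heisenberg-Virasoro algebra $\mathcal{H}$ is trivial; that is, if $\cdot$ is a commutative post-Lie algebra structure on $\mathcal{H}$, then $x\cdot y=0$ for all $x,y\in\mathcal{H}$.
   Context: The twisted Heisenberg-Virasoro algebra $\mathcal{H}$ is the complex Lie algebra with $\mathbb{C}$-basis $\{L_n,I_n,C_1,C_2,C_3\mid n\in\mathbb{Z}\}$ and Lie brackets, for all $m,n\in\mathbb{Z}$, $$[L_n,L_m]=(n-m)L_{m+n}+\tfrac{n^3-n}{12}\delta_{n,-m}C_1,\quad [L_n,I_m]=-mI_{m+n}-(n^2+n)\delta_{n,-m}C_2,\quad [I_n,I_m]=n\delta_{n,-m}C_3,$$ $$[\mathcal{H},C_1]=[\mathcal{H},C_2]=[\mathcal{H},C_3]=0.$$ A commutative post-Lie algebra structure on a complex Lie algebra $(L,[\,,])$ is a $\mathbb{C}$-bilinear product $x\cdot y$ on $L$ such that for all $x,y,z\in L$: $x\cdot y=y\cdot x$; $[x,y]\cdot z=x\cdot(y\cdot z)-y\cdot(x\cdot z)$; and $x\cdot[y,z]=[x\cdot y,z]+[y,x\cdot z]$. *)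

theory Defs
  imports Complex_Main "HOL-Library.Poly_Mapping"
begin

section \<open>Complex Lie algebras and commutative post-Lie structures\<close>

locale complex_lie_algebra = vector_space scale
  for scale :: "complex \<Rightarrow> 'a::ab_group_add \<Rightarrow> 'a" +
  fixes bracket :: "'a \<Rightarrow> 'a \<Rightarrow> 'a"
  assumes bracket_linear_right: "Vector_Spaces.linear scale scale (\<lambda>y. bracket x y)"
    and bracket_linear_left: "Vector_Spaces.linear scale scale (\<lambda>x. bracket x y)"
    and bracket_self: "bracket x x = 0"
    and jacobi: "bracket x (bracket y z) + bracket y (bracket z x) + bracket z (bracket x y) = 0"

locale comm_post_lie_structure = complex_lie_algebra scale bracket
  for scale :: "complex \<Rightarrow> 'a::ab_group_add \<Rightarrow> 'a"
    and bracket :: "'a \<Rightarrow> 'a \<Rightarrow> 'a" +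
  fixes prd :: "'a \<Rightarrow> 'a \<Rightarrow> 'a"
  assumes prd_linear_right: "Vector_Spaces.linear scale scale (\<lambda>y. prd x y)"
    and prd_linear_left: "Vector_Spaces.linear scale scale (\<lambda>x. prd x y)"
    and prd_commute: "prd x y = prd y x"
    and prd_bracket_left: "prd (bracket x y) z = prd x (prd y z) - prd y (prd x z)"
    and prd_bracket_right: "prd x (bracket y z) = bracket (prd x y) z + bracket y (prd x z)"


section \<open>The twisted Heisenberg-Virasoro algebra\<close>

datatype hv_basis = HV_L int | HV_I int | HV_C1 | HV_C2 | HV_C3

text \<open>
  The underlying vector space is the space of finitely supported functions from
  \<^typ>\<open>hv_basis\<close> to \<^typ>\<open>complex\<close>; \<open>Poly_Mapping.single b 1\<close> is the basis vector \<open>b\<close>.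
\<close>

type_synonym hv = "hv_basis \<Rightarrow>\<^sub>0 complex"

definition hv_scale :: "complex \<Rightarrow> hv \<Rightarrow> hv" where
  "hv_scale c x = Poly_Mapping.map ((*) c) x"

fun hv_basis_bracket :: "hv_basis \<Rightarrow> hv_basis \<Rightarrow> hv" where
  "hv_basis_bracket (HV_L n) (HV_L m) =
     Poly_Mapping.single (HV_L (m + n)) (of_int (n - m))
     + Poly_Mapping.single HV_C1 (if n = - m then of_int (n ^ 3 - n) / 12 else 0)"
| "hv_basis_bracket (HV_L n) (HV_I m) =
     Poly_Mapping.single (HV_I (m + n)) (- of_int m)
     - Poly_Mapping.single HV_C2 (if n = - m then of_int (n ^ 2 + n) else 0)"
| "hv_basis_bracket (HV_I m) (HV_L n) =
     - (Poly_Mapping.single (HV_I (m + n)) (- of_int m)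
        - Poly_Mapping.single HV_C2 (if n = - m then of_int (n ^ 2 + n) else 0))"
| "hv_basis_bracket (HV_I n) (HV_I m) =
     Poly_Mapping.single HV_C3 (if n = - m then of_int n else 0)"
| "hv_basis_bracket _ _ = 0"

definition hv_bracket :: "hv \<Rightarrow> hv \<Rightarrow> hv" where
  "hv_bracket x y =
     (\<Sum>a\<in>Poly_Mapping.keys x. \<Sum>b\<in>Poly_Mapping.keys y.
        hv_scale (Poly_Mapping.lookup x a * Poly_Mapping.lookup y b) (hv_basis_bracket a b))"


section \<open>The twisted Heisenberg-Virasoro algebra is a complex Lie algebra\<close>

lemma lookup_hv_scale [simp]:
  "Poly_Mapping.lookup (hv_scale c x) k = c * Poly_Mapping.lookup x k"
  by (simp add: hv_scale_def map.rep_eq when_def)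

lemma hv_scale_add_right: "hv_scale c (x + y) = hv_scale c x + hv_scale c y"
  by (rule poly_mapping_eqI) (simp add: lookup_add algebra_simps)

lemma hv_scale_add_left: "hv_scale (c + d) x = hv_scale c x + hv_scale d x"
  by (rule poly_mapping_eqI) (simp add: lookup_add algebra_simps)

lemma hv_scale_scale: "hv_scale c (hv_scale d x) = hv_scale (c * d) x"
  by (rule poly_mapping_eqI) simp

lemma hv_scale_one: "hv_scale 1 x = x"
  by (rule poly_mapping_eqI) simp

lemma hv_scale_zero_left [simp]: "hv_scale 0 x = 0"
  by (rule poly_mapping_eqI) simp

lemma hv_scale_zero_right [simp]: "hv_scale c 0 = 0"
  by (rule poly_mapping_eqI) simp

lemma hv_scale_sum: "hv_scale c (sum f A) = (\<Sum>a\<in>A. hv_scale c (f a))"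
  by (induction A rule: infinite_finite_induct) (simp_all add: hv_scale_add_right)

lemma hv_vector_space: "vector_space hv_scale"
  by unfold_locales
    (simp_all add: hv_scale_add_right hv_scale_add_left hv_scale_scale hv_scale_one)

lemma hv_bracket_superset:
  assumes "finite A" "finite B" "Poly_Mapping.keys x \<subseteq> A" "Poly_Mapping.keys y \<subseteq> B"
  shows "hv_bracket x y = (\<Sum>a\<in>A. \<Sum>b\<in>B.
    hv_scale (Poly_Mapping.lookup x a * Poly_Mapping.lookup y b) (hv_basis_bracket a b))"
proof -
  let ?f = "\<lambda>a b. hv_scale (Poly_Mapping.lookup x a * Poly_Mapping.lookup y b) (hv_basis_bracket a b)"
  have "hv_bracket x y = (\<Sum>a\<in>Poly_Mapping.keys x. \<Sum>b\<in>B. ?f a b)"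
    unfolding hv_bracket_def using assms
    by (intro sum.cong refl sum.mono_neutral_left) (auto simp: in_keys_iff)
  also have "\<dots> = (\<Sum>a\<in>A. \<Sum>b\<in>B. ?f a b)"
    using assms by (intro sum.mono_neutral_left) (auto simp: in_keys_iff)
  finally show ?thesis .
qed

lemma hv_bracket_add_left: "hv_bracket (x + x') y = hv_bracket x y + hv_bracket x' y"
proof -
  let ?A = "Poly_Mapping.keys x \<union> Poly_Mapping.keys x'"
  let ?B = "Poly_Mapping.keys y"
  have s: "Poly_Mapping.keys (x + x') \<subseteq> ?A" by (rule keys_add)
  show ?thesis
    by (subst (1 2 3) hv_bracket_superset[where A = ?A and B = ?B])
      (use s in \<open>auto simp: lookup_add algebra_simps hv_scale_add_left sum.distrib\<close>)
qed

lemma hv_bracket_add_right: "hv_bracket x (y + y') = hv_bracket x y + hv_bracket x y'"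
proof -
  let ?B = "Poly_Mapping.keys y \<union> Poly_Mapping.keys y'"
  let ?A = "Poly_Mapping.keys x"
  have s: "Poly_Mapping.keys (y + y') \<subseteq> ?B" by (rule keys_add)
  show ?thesis
    by (subst (1 2 3) hv_bracket_superset[where A = ?A and B = ?B])
      (use s in \<open>auto simp: lookup_add algebra_simps hv_scale_add_left sum.distrib\<close>)
qed

lemma hv_bracket_scale_left: "hv_bracket (hv_scale c x) y = hv_scale c (hv_bracket x y)"
proof -
  have s: "Poly_Mapping.keys (hv_scale c x) \<subseteq> Poly_Mapping.keys x"
    by (auto simp: in_keys_iff)
  show ?thesis
    by (subst hv_bracket_superset[OF _ _ s order_refl])
      (simp_all add: hv_bracket_def hv_scale_sum hv_scale_scale mult.assoc)
qed

lemma hv_bracket_scale_right: "hv_bracket x (hv_scale c y) = hv_scale c (hv_bracket x y)"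
proof -
  have s: "Poly_Mapping.keys (hv_scale c y) \<subseteq> Poly_Mapping.keys y"
    by (auto simp: in_keys_iff)
  show ?thesis
    by (subst hv_bracket_superset[OF _ _ order_refl s])
      (simp_all add: hv_bracket_def hv_scale_sum hv_scale_scale mult.left_commute)
qed

lemma hv_bracket_zero [simp]: "hv_bracket 0 y = 0" "hv_bracket x 0 = 0"
  by (simp_all add: hv_bracket_def)

lemma hv_bracket_minus:
  "hv_bracket (- x) y = - hv_bracket x y" "hv_bracket x (- y) = - hv_bracket x y"
  using hv_bracket_add_left[of "- x" x y] hv_bracket_add_right[of x "- y" y]
  by (simp_all add: add_eq_0_iff2)

lemma hv_bracket_diff:
  "hv_bracket (x - x') y = hv_bracket x y - hv_bracket x' y"
  "hv_bracket x (y - y') = hv_bracket x y - hv_bracket x y'"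
  using hv_bracket_add_left[of x "- x'" y] hv_bracket_add_right[of x y "- y'"]
  by (simp_all add: hv_bracket_minus)

lemma hv_bracket_single:
  "hv_bracket (Poly_Mapping.single a c) (Poly_Mapping.single b d) = hv_scale (c * d) (hv_basis_bracket a b)"
  by (simp add: hv_bracket_def)

lemma hv_basis_bracket_antisym: "hv_basis_bracket a b = - hv_basis_bracket b a"
  by (cases a; cases b)
    (auto intro!: poly_mapping_eqI
      simp: lookup_add lookup_minus lookup_single when_def add.commute field_simps)

lemma hv_induct [case_names single add]:
  assumes single: "\<And>a c. P (Poly_Mapping.single a c)"
    and add: "\<And>x y. P x \<Longrightarrow> P y \<Longrightarrow> P (x + y)"
  shows "P (x :: hv)"
proof -
  have "P (\<Sum>a\<in>A. Poly_Mapping.single a (Poly_Mapping.lookup x a))" if "finite A" for A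
    using that
  proof (induction A)
    case empty
    show ?case using single[of HV_C1 0] by simp
  qed (simp add: add single)
  moreover have "(\<Sum>a\<in>Poly_Mapping.keys x. Poly_Mapping.single a (Poly_Mapping.lookup x a)) = x"
    by (rule poly_mapping_eqI) (auto simp: lookup_sum lookup_single when_def in_keys_iff)
  ultimately show ?thesis by (metis finite_keys)
qed

lemma hv_bracket_antisym: "hv_bracket x y = - hv_bracket y x"
proof (induction x rule: hv_induct)
  case (single a c)
  show ?case
  proof (induction y rule: hv_induct)
    case (single b d)
    show ?case
      by (subst (1 2) hv_bracket_single, subst hv_basis_bracket_antisym, rule poly_mapping_eqI)
        simp
  qed (simp add: hv_bracket_add_left hv_bracket_add_right)
qed (simp add: hv_bracket_add_left hv_bracket_add_right)

lemma hv_bracket_self: "hv_bracket x x = 0"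
proof (rule poly_mapping_eqI)
  fix k
  have "Poly_Mapping.lookup (hv_bracket x x) k = - Poly_Mapping.lookup (hv_bracket x x) k"
    by (metis hv_bracket_antisym lookup_uminus)
  then show "Poly_Mapping.lookup (hv_bracket x x) k = Poly_Mapping.lookup 0 k"
    by simp
qed

lemma hv_scale_single: "hv_scale k (Poly_Mapping.single a c) = Poly_Mapping.single a (k * c)"
  by (rule poly_mapping_eqI) (simp add: lookup_single when_def)

lemma hv_scale_minus: "hv_scale k (- x) = - hv_scale k x"
  by (rule poly_mapping_eqI) simp

lemma hv_scale_diff: "hv_scale k (x - y) = hv_scale k x - hv_scale k y"
  by (rule poly_mapping_eqI) (simp add: lookup_minus algebra_simps)

definition hv_jacobiator :: "hv \<Rightarrow> hv \<Rightarrow> hv \<Rightarrow> hv" where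
  "hv_jacobiator x y z =
     hv_bracket x (hv_bracket y z) + hv_bracket y (hv_bracket z x) + hv_bracket z (hv_bracket x y)"

lemma hv_jacobiator_cycle: "hv_jacobiator x y z = hv_jacobiator y z x"
  by (simp add: hv_jacobiator_def algebra_simps)

lemma hv_jacobiator_add: "hv_jacobiator (x + x') y z = hv_jacobiator x y z + hv_jacobiator x' y z"
  by (simp add: hv_jacobiator_def hv_bracket_add_left hv_bracket_add_right algebra_simps)

lemmas hv_bracket_simps =
  hv_bracket_single hv_bracket_add_left hv_bracket_add_right hv_bracket_diff hv_bracket_minus
  hv_scale_add_right hv_scale_diff hv_scale_minus hv_scale_single

lemmas hv_lookup_simps = lookup_add lookup_minus lookup_single when_def

lemma hv_jacobiator_LLL:
  "hv_jacobiator (Poly_Mapping.single (HV_L n) c) (Poly_Mapping.single (HV_L m) d)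
     (Poly_Mapping.single (HV_L p) e) = 0"
proof (rule poly_mapping_eqI, cases "n + m + p = 0")
  case True
  then have p: "p = - n - m" by simp
  fix k
  show "Poly_Mapping.lookup (hv_jacobiator (Poly_Mapping.single (HV_L n) c)
    (Poly_Mapping.single (HV_L m) d) (Poly_Mapping.single (HV_L p) e)) k = Poly_Mapping.lookup 0 k"
    unfolding p hv_jacobiator_def
    by (cases k) (simp_all add: hv_bracket_simps hv_lookup_simps, (simp add: field_simps power3_eq_cube)+)
next
  case False
  then have ne: "n \<noteq> - (m + p)" "n \<noteq> - (p + m)" "m \<noteq> - (n + p)" "m \<noteq> - (p + n)"
    "p \<noteq> - (n + m)" "p \<noteq> - (m + n)" by linarith+
  fix k
  show "Poly_Mapping.lookup (hv_jacobiator (Poly_Mapping.single (HV_L n) c)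
    (Poly_Mapping.single (HV_L m) d) (Poly_Mapping.single (HV_L p) e)) k = Poly_Mapping.lookup 0 k"
    unfolding hv_jacobiator_def using ne
    by (cases k) (simp_all add: hv_bracket_simps hv_lookup_simps, (simp add: algebra_simps)+)
qed

lemma hv_jacobiator_LLI:
  "hv_jacobiator (Poly_Mapping.single (HV_L n) c) (Poly_Mapping.single (HV_L m) d)
     (Poly_Mapping.single (HV_I p) e) = 0"
proof (rule poly_mapping_eqI, cases "n + m + p = 0")
  case True
  then have p: "p = - n - m" by simp
  fix k
  show "Poly_Mapping.lookup (hv_jacobiator (Poly_Mapping.single (HV_L n) c)
    (Poly_Mapping.single (HV_L m) d) (Poly_Mapping.single (HV_I p) e)) k = Poly_Mapping.lookup 0 k"
    unfolding p hv_jacobiator_def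
    by (cases k) (simp_all add: hv_bracket_simps hv_lookup_simps, (simp add: field_simps power2_eq_square)+)
next
  case False
  then have ne: "n \<noteq> - (m + p)" "n \<noteq> - (p + m)" "m \<noteq> - (n + p)" "m \<noteq> - (p + n)"
    "p \<noteq> - (n + m)" "p \<noteq> - (m + n)" "n + m \<noteq> - p" "m + n \<noteq> - p" by linarith+
  fix k
  show "Poly_Mapping.lookup (hv_jacobiator (Poly_Mapping.single (HV_L n) c)
    (Poly_Mapping.single (HV_L m) d) (Poly_Mapping.single (HV_I p) e)) k = Poly_Mapping.lookup 0 k"
    unfolding hv_jacobiator_def using ne
    by (cases k) (simp_all add: hv_bracket_simps hv_lookup_simps, (simp add: algebra_simps)+)
qed

lemma hv_jacobiator_LII:
  "hv_jacobiator (Poly_Mapping.single (HV_L n) c) (Poly_Mapping.single (HV_I m) d)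
     (Poly_Mapping.single (HV_I p) e) = 0"
  by (rule poly_mapping_eqI)
    (auto simp: hv_jacobiator_def hv_bracket_simps hv_lookup_simps algebra_simps)

lemma hv_jacobiator_III:
  "hv_jacobiator (Poly_Mapping.single (HV_I n) c) (Poly_Mapping.single (HV_I m) d)
     (Poly_Mapping.single (HV_I p) e) = 0"
  by (simp add: hv_jacobiator_def hv_bracket_simps)

lemma hv_basis_bracket_central [simp]:
  "hv_basis_bracket a HV_C1 = 0" "hv_basis_bracket a HV_C2 = 0" "hv_basis_bracket a HV_C3 = 0"
  by (cases a; simp)+

lemma hv_bracket_central:
  assumes "a \<in> {HV_C1, HV_C2, HV_C3}"
  shows "hv_bracket (Poly_Mapping.single a c) x = 0" "hv_bracket x (Poly_Mapping.single a c) = 0"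
  using assms by (auto simp: hv_bracket_def)

lemma hv_jacobiator_central:
  assumes "a \<in> {HV_C1, HV_C2, HV_C3}"
  shows "hv_jacobiator (Poly_Mapping.single a c) x y = 0"
  by (simp add: hv_jacobiator_def hv_bracket_central[OF assms])

lemma hv_jacobiator_central':
  assumes "a \<in> {HV_C1, HV_C2, HV_C3}"
  shows "hv_jacobiator x (Poly_Mapping.single a c) y = 0" "hv_jacobiator x y (Poly_Mapping.single a c) = 0"
  using hv_jacobiator_central[OF assms] hv_jacobiator_cycle by metis+

lemma hv_jacobiator_single:
  "hv_jacobiator (Poly_Mapping.single a c) (Poly_Mapping.single b d) (Poly_Mapping.single f e) = 0"
proof -
  note J = hv_jacobiator_LLL hv_jacobiator_LLI hv_jacobiator_LII hv_jacobiator_III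
  have J': "hv_jacobiator y z x = 0" "hv_jacobiator z x y = 0" if "hv_jacobiator x y z = 0" for x y z
    using that hv_jacobiator_cycle by metis+
  show ?thesis
    by (cases a; cases b; cases f)
      (simp_all add: hv_jacobiator_central hv_jacobiator_central' J J[THEN J'(1)] J[THEN J'(2)])
qed

lemma hv_jacobiator_eq_0: "hv_jacobiator x y z = 0"
proof (induction x rule: hv_induct)
  case (single a c)
  show ?case
    unfolding hv_jacobiator_cycle[of "Poly_Mapping.single a c"]
  proof (induction y rule: hv_induct)
    case (single b d)
    show ?case
      unfolding hv_jacobiator_cycle[of "Poly_Mapping.single b d"]
    proof (induction z rule: hv_induct)
      case (single f e)
      show ?case by (rule hv_jacobiator_single)
    qed (simp add: hv_jacobiator_add)
  qed (simp add: hv_jacobiator_add)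
qed (simp add: hv_jacobiator_add)

lemma hv_complex_lie_algebra: "complex_lie_algebra hv_scale hv_bracket"
proof -
  interpret vector_space hv_scale by (rule hv_vector_space)
  show ?thesis
    by unfold_locales
      (simp_all add: hv_bracket_add_left hv_bracket_add_right hv_bracket_scale_left
        hv_bracket_scale_right hv_bracket_self hv_jacobiator_eq_0[unfolded hv_jacobiator_def])
qed

end

theory Submission
  imports Defs
begin

text \<open>
  The proof plays the perfectness of \<open>\<H>\<close> against its large centre, which contains \<open>I\<^sub>0\<close> besides
  \<open>C\<^sub>1, C\<^sub>2, C\<^sub>3\<close>. The axioms make every left multiplication \<open>y \<mapsto> x \<cdot> y\<close> a derivation. A derivation with
  values in the centre kills all brackets, hence is \<open>0\<close>; and \<open>x \<cdot> z\<close> is central whenever \<open>z\<close> is. By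
  commutativity, a central \<open>z\<close> therefore multiplies everything to \<open>0\<close>. This disposes of all the cocycle
  terms, and it leaves only the coefficients at the \<open>L\<^sub>j\<close> and the \<open>I\<^sub>j\<close> to be computed.

  The coefficients at the \<open>L\<^sub>j\<close> vanish (\<open>product_coeff_L\<close>). Comparing coefficients in
  \<open>x \<cdot> [L\<^sub>k, I\<^sub>m]\<close> gives this for \<open>x \<cdot> I\<^sub>m\<close>, so the product induces a symmetric biderivation on the
  Witt algebra. Weights with respect to \<open>L\<^sub>0\<close> force the product of two distinct generators to be
  proportional to their bracket, and the antisymmetry of the bracket is incompatible with commutativity.

  So all products lie in the ideal \<open>J\<close> spanned by the \<open>I\<^sub>m\<close> and the centre. As \<open>[J, J]\<close> is central,
  \<open>x \<cdot> I\<^sub>m\<close> is a multiple \<open>d(x) I\<^sub>m\<close> modulo the \<open>C\<^sub>i\<close>, again by weights, and comparing coefficients in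
  \<open>x \<cdot> [L\<^sub>k, I\<^sub>1]\<close> shows that \<open>d(x)\<close> is the same for all \<open>m\<close>, including \<open>m = 0\<close>. But \<open>x \<cdot> I\<^sub>0 = 0\<close>, because
  \<open>I\<^sub>0\<close> is central; hence \<open>d = 0\<close>, the products \<open>x \<cdot> I\<^sub>m\<close> are central, and by the first paragraph they are \<open>0\<close>.
  Now \<open>J\<close> multiplies to \<open>0\<close> and contains all products, so
  \<open>[x, y] \<cdot> z = x \<cdot> (y \<cdot> z) - y \<cdot> (x \<cdot> z) = 0\<close>, and perfectness finishes the proof.

  Symmetry and the derivation property alone would not carry this last step: on the quotient of \<open>\<H>\<close> by its centre, \<open>L\<^sub>m \<cdot> L\<^sub>n = I\<^sub>m\<^sub>+\<^sub>n\<close>, with all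
  other products of generators equal to \<open>0\<close>, is a nonzero symmetric biderivation.
\<close>

section \<open>Coefficients of brackets, the centre, and perfectness\<close>

abbreviation L_elt :: "int \<Rightarrow> hv" where
  "L_elt n \<equiv> Poly_Mapping.single (HV_L n) 1"

abbreviation I_elt :: "int \<Rightarrow> hv" where
  "I_elt n \<equiv> Poly_Mapping.single (HV_I n) 1"

abbreviation L_coeff :: "hv \<Rightarrow> int \<Rightarrow> complex" where
  "L_coeff x j \<equiv> Poly_Mapping.lookup x (HV_L j)"

abbreviation I_coeff :: "hv \<Rightarrow> int \<Rightarrow> complex" where
  "I_coeff x j \<equiv> Poly_Mapping.lookup x (HV_I j)"

lemma L_coeff_bracket_L_right:
  "L_coeff (hv_bracket x (L_elt m)) j = of_int (j - 2 * m) * L_coeff x (j - m)"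
proof (induction x rule: hv_induct)
  case (single a c)
  show ?case
    by (cases a) (auto simp: hv_bracket_single hv_lookup_simps)
qed (simp add: hv_bracket_add_left lookup_add algebra_simps)

lemma L_coeff_bracket_L_left:
  "L_coeff (hv_bracket (L_elt m) x) j = of_int (2 * m - j) * L_coeff x (j - m)"
  using L_coeff_bracket_L_right[of x m j]
  by (subst hv_bracket_antisym) (simp add: algebra_simps)

lemma L_coeff_bracket_I_right:
  "L_coeff (hv_bracket x (I_elt m)) j = 0"
proof (induction x rule: hv_induct)
  case (single a c)
  show ?case
    by (cases a) (auto simp: hv_bracket_single hv_lookup_simps)
qed (simp add: hv_bracket_add_left lookup_add)

lemma I_coeff_bracket_I_right:
  "I_coeff (hv_bracket x (I_elt m)) j = - of_int m * L_coeff x (j - m)"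
proof (induction x rule: hv_induct)
  case (single a c)
  show ?case
    by (cases a) (auto simp: hv_bracket_single hv_lookup_simps)
qed (simp add: hv_bracket_add_left lookup_add algebra_simps)

lemma I_coeff_bracket_L_left:
  "I_coeff (hv_bracket (L_elt m) x) j = of_int (m - j) * I_coeff x (j - m)"
proof (induction x rule: hv_induct)
  case (single a c)
  show ?case
    by (cases a) (auto simp: hv_bracket_single hv_lookup_simps)
qed (simp add: hv_bracket_add_right lookup_add algebra_simps)

definition hv_central :: "hv \<Rightarrow> bool" where
  "hv_central z \<longleftrightarrow> (\<forall>x. hv_bracket x z = 0)"

lemma hv_centralD: "hv_central z \<Longrightarrow> hv_bracket x z = 0" "hv_central z \<Longrightarrow> hv_bracket z x = 0"
  using hv_bracket_antisym[of z x] by (auto simp: hv_central_def)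

text \<open>
  The coefficient at \<open>I\<^sub>0\<close> is left free: \<open>I\<^sub>0\<close> is central because both terms of \<open>[L\<^sub>n, I\<^sub>0]\<close> vanish.
\<close>

lemma hv_centralI:
  assumes L: "\<And>j. L_coeff z j = 0" and I: "\<And>j. j \<noteq> 0 \<Longrightarrow> I_coeff z j = 0"
  shows "hv_central z"
proof -
  have "hv_basis_bracket b a = 0" if "a \<in> Poly_Mapping.keys z" for a b
  proof (cases a)
    case (HV_I n)
    with that I[of n] have "n = 0" by (auto simp: in_keys_iff)
    with HV_I show ?thesis by (cases b) simp_all
  qed (use that L in \<open>auto simp: in_keys_iff\<close>)
  then show ?thesis
    by (simp add: hv_central_def hv_bracket_def)
qed

text \<open>
  \<open>\<H>\<close> equals its derived algebra, phrased as an induction rule. Each \<open>L\<^sub>n\<close> and \<open>I\<^sub>n\<close> with \<open>n \<noteq> 0\<close> is a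
  multiple of its bracket with \<open>L\<^sub>0\<close>; then \<open>[L\<^sub>1, L\<^sub>-\<^sub>1]\<close> and \<open>[L\<^sub>-\<^sub>1, I\<^sub>1]\<close>, where the cocycles
  vanish, give \<open>L\<^sub>0\<close> and \<open>I\<^sub>0\<close>; and \<open>[L\<^sub>2, L\<^sub>-\<^sub>2]\<close>, \<open>[L\<^sub>1, I\<^sub>-\<^sub>1]\<close>, \<open>[I\<^sub>1, I\<^sub>-\<^sub>1]\<close> give the \<open>C\<^sub>i\<close>.
\<close>

lemma hv_perfect_induct [case_names bracket diff]:
  assumes bracket: "\<And>x y. P (hv_bracket x y)"
    and diff: "\<And>x y. P x \<Longrightarrow> P y \<Longrightarrow> P (x - y)"
  shows "P z"
proof -
  have basis: "P (Poly_Mapping.single a c)" for a c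
  proof -
    have L0: "P (Poly_Mapping.single (HV_L 0) c)" for c
      using bracket[of "Poly_Mapping.single (HV_L 1) (c / 2)" "L_elt (-1)"]
      by (simp add: hv_bracket_simps)
    have I0: "P (Poly_Mapping.single (HV_I 0) c)" for c
      using bracket[of "Poly_Mapping.single (HV_L (-1)) (- c)" "I_elt 1"]
      by (simp add: hv_bracket_simps)
    show ?thesis
    proof (cases a)
      case (HV_L n)
      then show ?thesis
        using L0 bracket[of "Poly_Mapping.single (HV_L n) (c / of_int n)" "L_elt 0"]
        by (cases "n = 0") (auto simp: hv_bracket_simps)
    next
      case (HV_I n)
      then show ?thesis
        using I0 bracket[of "Poly_Mapping.single (HV_I n) (c / of_int n)" "L_elt 0"]
        by (cases "n = 0") (auto simp: hv_bracket_simps simp flip: single_uminus)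
    next
      case HV_C1
      have "hv_bracket (Poly_Mapping.single (HV_L 2) (2 * c)) (L_elt (-2))
          - Poly_Mapping.single (HV_L 0) (8 * c) = Poly_Mapping.single HV_C1 c"
        by (simp add: hv_bracket_simps)
      with diff[OF bracket L0] HV_C1 show ?thesis by metis
    next
      case HV_C2
      have "Poly_Mapping.single (HV_I 0) (c / 2)
          - hv_bracket (Poly_Mapping.single (HV_L 1) (c / 2)) (I_elt (-1)) = Poly_Mapping.single HV_C2 c"
        by (simp add: hv_bracket_simps)
      with diff[OF I0 bracket] HV_C2 show ?thesis by metis
    next
      case HV_C3
      then show ?thesis
        using bracket[of "Poly_Mapping.single (HV_I 1) c" "I_elt (-1)"]
        by (simp add: hv_bracket_simps)
    qed
  qed
  show ?thesis
  proof (induction z rule: hv_induct)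
    case (single a c)
    show ?case by (rule basis)
  next
    case (add x y)
    have "P (0 - y)"
      using diff[OF diff[OF add(2) add(2)] add(2)] by simp
    from diff[OF add(1) this] show ?case by simp
  qed
qed


section \<open>Central elements annihilate\<close>

locale hv_post_lie = comm_post_lie_structure hv_scale hv_bracket prd
  for prd :: "hv \<Rightarrow> hv \<Rightarrow> hv" (infixl "\<cdot>" 70)
begin

lemma prd_add_right: "x \<cdot> (y + z) = x \<cdot> y + x \<cdot> z"
  by (rule module_hom.add[OF prd_linear_right[unfolded linear_iff_module_hom]])

lemma prd_diff_right: "x \<cdot> (y - z) = x \<cdot> y - x \<cdot> z"
  using prd_add_right[of x "y - z" z] by simp

lemma prd_scale_right: "x \<cdot> hv_scale c y = hv_scale c (x \<cdot> y)"
  by (rule module_hom.scale[OF prd_linear_right[unfolded linear_iff_module_hom]])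

lemma prd_zero_right: "x \<cdot> 0 = 0"
  using prd_diff_right[of x 0 0] by simp

lemma prd_single_right: "x \<cdot> Poly_Mapping.single a c = hv_scale c (x \<cdot> Poly_Mapping.single a 1)"
  using prd_scale_right[of x c "Poly_Mapping.single a 1"] by (simp add: hv_scale_single)

text \<open>
  \<open>x \<mapsto> a \<cdot> x\<close> is a derivation with central values, so it kills every bracket.
\<close>

lemma prd_eq_0_if_central_values:
  assumes "\<And>x. hv_central (a \<cdot> x)"
  shows "a \<cdot> x = 0"
proof (induction x rule: hv_perfect_induct)
  case (bracket x y)
  show ?case by (simp add: prd_bracket_right hv_centralD[OF assms])
qed (simp add: prd_diff_right)

text \<open>
  A derivation \<open>y \<cdot> _\<close> maps the centre to itself: apply it to \<open>[w, z] = 0\<close>. By commutativity this says that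
  \<open>z \<cdot> _\<close> has central values.
\<close>

lemma prd_central_right:
  assumes "hv_central z"
  shows "x \<cdot> z = 0"
proof -
  have "hv_central (z \<cdot> y)" for y
    unfolding hv_central_def
  proof
    fix w
    have "y \<cdot> hv_bracket w z = hv_bracket (y \<cdot> w) z + hv_bracket w (y \<cdot> z)"
      by (rule prd_bracket_right)
    then show "hv_bracket w (z \<cdot> y) = 0"
      by (simp add: hv_centralD[OF assms] prd_zero_right prd_commute[of z])
  qed
  then have "z \<cdot> x = 0" by (rule prd_eq_0_if_central_values)
  then show ?thesis by (simp add: prd_commute)
qed

lemma prd_C_right:
  "x \<cdot> Poly_Mapping.single HV_C1 c = 0" "x \<cdot> Poly_Mapping.single HV_C2 c = 0"
  "x \<cdot> Poly_Mapping.single HV_C3 c = 0" "x \<cdot> Poly_Mapping.single (HV_I 0) c = 0"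
  by (rule prd_central_right, rule hv_centralI; simp add: lookup_single)+

lemma prd_bracket_L_L:
  "hv_scale (of_int (k - m)) (x \<cdot> L_elt (k + m))
     = hv_bracket (x \<cdot> L_elt k) (L_elt m) + hv_bracket (L_elt k) (x \<cdot> L_elt m)"
proof -
  have "x \<cdot> hv_bracket (L_elt k) (L_elt m) = hv_scale (of_int (k - m)) (x \<cdot> L_elt (k + m))"
    unfolding hv_bracket_single hv_basis_bracket.simps hv_scale_one mult_1 prd_add_right prd_C_right
    by (subst prd_single_right) (simp add: add.commute)
  then show ?thesis by (simp add: prd_bracket_right)
qed

lemma prd_bracket_L_I:
  "hv_scale (- of_int m) (x \<cdot> I_elt (k + m))
     = hv_bracket (x \<cdot> L_elt k) (I_elt m) + hv_bracket (L_elt k) (x \<cdot> I_elt m)"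
proof -
  have "x \<cdot> hv_bracket (L_elt k) (I_elt m) = hv_scale (- of_int m) (x \<cdot> I_elt (k + m))"
    unfolding hv_bracket_single hv_basis_bracket.simps hv_scale_one mult_1 prd_diff_right prd_C_right
    by (subst prd_single_right) (simp add: add.commute)
  then show ?thesis by (simp add: prd_bracket_right)
qed


section \<open>The induced product on the Witt algebra vanishes\<close>

lemma L_coeff_prd_L_L:
  "of_int (k - m) * L_coeff (x \<cdot> L_elt (k + m)) j
     = of_int (j - 2 * m) * L_coeff (x \<cdot> L_elt k) (j - m)
       + of_int (2 * k - j) * L_coeff (x \<cdot> L_elt m) (j - k)"
  using arg_cong[OF prd_bracket_L_L[of k m x], of "\<lambda>u. L_coeff u j"]
  by (simp add: lookup_add L_coeff_bracket_L_right L_coeff_bracket_L_left)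

text \<open>
  The case \<open>k = 0\<close> of the previous identity, in which \<open>ad L\<^sub>0\<close> acts by weights: off the weight \<open>m\<close>, the
  product \<open>x \<cdot> L\<^sub>m\<close> is determined by \<open>x \<cdot> L\<^sub>0\<close>.
\<close>

lemma L_coeff_prd_L_weight:
  "of_int (j - m) * L_coeff (x \<cdot> L_elt m) j = of_int (j - 2 * m) * L_coeff (x \<cdot> L_elt 0) (j - m)"
  using L_coeff_prd_L_L[of 0 m x j] by (simp add: algebra_simps)

text \<open>
  There is no contribution of \<open>x \<cdot> L\<^sub>k\<close> here, since brackets with \<open>I\<^sub>m\<close> have no \<open>L\<close>-part.
\<close>

lemma L_coeff_prd_L_I:
  "- of_int m * L_coeff (x \<cdot> I_elt (k + m)) j = of_int (2 * k - j) * L_coeff (x \<cdot> I_elt m) (j - k)"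
  using arg_cong[OF prd_bracket_L_I[of m x k], of "\<lambda>u. L_coeff u j"]
  by (simp add: lookup_add L_coeff_bracket_I_right L_coeff_bracket_L_left)

lemma L_coeff_prd_I: "L_coeff (x \<cdot> I_elt m) j = 0"
proof (cases "j = m")
  case False
  then have "(of_int (m - j) :: complex) \<noteq> 0" by (simp del: of_int_diff)
  then show ?thesis
    using L_coeff_prd_L_I[of m x 0 j] by (simp add: algebra_simps)
next
  case True
  \<comment> \<open>The factor \<open>2 * k - j\<close> vanishes at \<open>k = 1\<close>, \<open>j = 2\<close>: this reflects \<open>[L\<^sub>1, L\<^sub>1] = 0\<close>. All other
    diagonal coefficients are multiples of this one.\<close>
  have 2: "L_coeff (x \<cdot> I_elt 2) 2 = 0"
    using L_coeff_prd_L_I[of 1 x 1 2] by simp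
  show ?thesis
    using L_coeff_prd_L_I[of 2 x "m - 2" m] by (simp add: True 2)
qed

lemma L_coeff_prd_L0_weight_0: "L_coeff (x \<cdot> L_elt 0) 0 = 0"
  using L_coeff_prd_L_weight[of 1 1 x] by simp

lemma L_coeff_prd_L0_off_diagonal:
  assumes "j \<noteq> m"
  shows "L_coeff (L_elt m \<cdot> L_elt 0) j = 0"
proof -
  have "L_coeff (L_elt 0 \<cdot> L_elt 0) k = 0" for k
    using L_coeff_prd_L_weight[of 0 "- k" "L_elt 0"] L_coeff_prd_L0_weight_0
    by (cases "k = 0") (simp_all add: prd_commute[of "L_elt 0" "L_elt (- k)"])
  then have "of_int (j - m) * L_coeff (L_elt 0 \<cdot> L_elt m) j = 0"
    using L_coeff_prd_L_weight[of j m "L_elt 0"] by simp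
  with assms show ?thesis
    by (simp add: prd_commute del: of_int_diff)
qed

text \<open>
  With \<open>e\<^sub>n\<close> the coefficient of \<open>L\<^sub>n\<close> in \<open>L\<^sub>n \<cdot> L\<^sub>0\<close>, the weight identity computes the coefficient of
  \<open>L\<^sub>n\<^sub>+\<^sub>m\<close> in \<open>L\<^sub>n \<cdot> L\<^sub>m\<close> as \<open>(n - m) e\<^sub>n / n\<close>. Symmetry in \<open>n\<close> and \<open>m\<close> then says that \<open>e\<^sub>n / n\<close>
  changes sign between any two distinct nonzero indices, which is impossible for three of them
  unless \<open>e\<close> vanishes.
\<close>

lemma L_coeff_prd_L0: "L_coeff (L_elt n \<cdot> L_elt 0) j = 0"
proof (cases "j = n \<and> n \<noteq> 0")
  case False
  then show ?thesis
    using L_coeff_prd_L0_off_diagonal L_coeff_prd_L0_weight_0 by (cases "j = n") auto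
next
  case True
  define e where "e n = L_coeff (L_elt n \<cdot> L_elt 0) n" for n
  have c: "of_int n * L_coeff (L_elt n \<cdot> L_elt m) (n + m) = of_int (n - m) * e n" for n m
    using L_coeff_prd_L_weight[of "n + m" m "L_elt n"] by (simp add: e_def)
  have swap: "of_int m * e n = - of_int n * e m" if "n \<noteq> m" for n m
  proof -
    have "of_int m * (of_int (n - m) * e n) = of_int n * (of_int (m - n) * e m)"
      unfolding c[symmetric] by (simp add: prd_commute[of "L_elt m" "L_elt n"] add.commute)
    then have "of_int (n - m) * (of_int m * e n + of_int n * e m) = 0"
      by (simp add: algebra_simps)
    with that show ?thesis
      by (simp add: add_eq_0_iff del: of_int_diff)
  qed
  have "of_int n * (e (2 * n) + 2 * e n) = 0"
    using swap[of n "2 * n"] True by (simp add: algebra_simps)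
  then have "e (2 * n) = - 2 * e n"
    using True by (simp add: add_eq_0_iff2)
  moreover have "e (- n) = e n" "e (2 * n) = 2 * e (- n)"
    using swap[of n "- n"] swap[of "- n" "2 * n"] True by auto
  ultimately have "e n = 0" by simp
  with True show ?thesis by (simp add: e_def)
qed

lemma L_coeff_prd_L: "L_coeff (L_elt n \<cdot> L_elt m) j = 0"
proof -
  have off: "L_coeff (L_elt n \<cdot> L_elt m) j = 0" if "j \<noteq> m" for n m j
    using L_coeff_prd_L_weight[of j m "L_elt n"] L_coeff_prd_L0 that by (simp del: of_int_diff)
  have neq: "L_coeff (L_elt n \<cdot> L_elt m) j = 0" if "n \<noteq> m" for n m j
    using off[of j m n] off[of j n m] that by (cases "j = m") (auto simp: prd_commute)
  have eq: "L_coeff (L_elt n \<cdot> L_elt n) n = 0"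
  proof -
    \<comment> \<open>Any bracket of \<open>L\<^sub>n\<close> with an \<open>L\<^sub>l\<close>, \<open>l \<notin> {0, n}\<close>, reduces this case to distinct indices.\<close>
    obtain l where l: "l \<noteq> 0" "l \<noteq> n"
      by (metis zero_neq_one zero_neq_numeral one_eq_numeral_iff num.distinct(1))
    have "of_int (n - l) * L_coeff (L_elt n \<cdot> L_elt n) n = 0"
      using L_coeff_prd_L_L[of n l "L_elt n" "n + l"] l by (simp add: neq)
    with l show ?thesis by (simp del: of_int_diff)
  qed
  show ?thesis
    using neq[of n m j] off[of j m n] eq by (cases "n = m"; cases "j = m") auto
qed

lemma prd_eq_0_if_basis:
  assumes "\<And>a. a \<in> Poly_Mapping.keys u \<Longrightarrow> x \<cdot> Poly_Mapping.single a 1 = 0"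
  shows "x \<cdot> u = 0"
proof -
  have "x \<cdot> (\<Sum>a\<in>A. Poly_Mapping.single a (Poly_Mapping.lookup u a)) = 0"
    if "finite A" "A \<subseteq> Poly_Mapping.keys u" for A
    using that
  proof (induction A)
    case (insert a A)
    then show ?case
      using assms[of a] prd_single_right[of x a "Poly_Mapping.lookup u a"] by (simp add: prd_add_right)
  qed (simp add: prd_zero_right)
  moreover have "(\<Sum>a\<in>Poly_Mapping.keys u. Poly_Mapping.single a (Poly_Mapping.lookup u a)) = u"
    by (rule poly_mapping_eqI) (auto simp: lookup_sum lookup_single when_def in_keys_iff)
  ultimately show ?thesis by (metis finite_keys order_refl)
qed

lemma product_coeff_L: "L_coeff (x \<cdot> y) j = 0"
proof -
  have single: "L_coeff (x \<cdot> Poly_Mapping.single a c) j = 0"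
    if "\<And>m. L_coeff (x \<cdot> L_elt m) j = 0" for x a c
    using that by (cases a) (simp_all add: prd_C_right prd_single_right[of x "HV_L _" c]
      prd_single_right[of x "HV_I _" c] L_coeff_prd_I)
  have "L_coeff (L_elt m \<cdot> x) j = 0" for m x
    by (induction x rule: hv_induct) (simp_all add: single L_coeff_prd_L prd_add_right lookup_add)
  then show ?thesis
    by (induction y rule: hv_induct) (simp_all add: single prd_commute[of x "L_elt _"] prd_add_right lookup_add)
qed


section \<open>The product vanishes\<close>

lemma I_coeff_prd_L_I:
  "of_int m * I_coeff (x \<cdot> I_elt (k + m)) j = of_int (j - k) * I_coeff (x \<cdot> I_elt m) (j - k)"
  using arg_cong[OF prd_bracket_L_I[of m x k], of "\<lambda>u. I_coeff u j"]
  by (simp add: lookup_add I_coeff_bracket_I_right I_coeff_bracket_L_left product_coeff_L algebra_simps)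

text \<open>
  The diagonal coefficient at \<open>I\<^sub>m\<close> does not depend on \<open>m\<close>, and it vanishes for the central \<open>I\<^sub>0\<close>.
\<close>

lemma I_coeff_prd_I: "I_coeff (x \<cdot> I_elt m) j = 0"
proof (cases "j = m")
  case False
  then have "(of_int (m - j) :: complex) \<noteq> 0" by (simp del: of_int_diff)
  then show ?thesis
    using I_coeff_prd_L_I[of m x 0 j] by (simp add: algebra_simps)
next
  case True
  have diag: "I_coeff (x \<cdot> I_elt m) m = I_coeff (x \<cdot> I_elt 1) 1" for m
    using I_coeff_prd_L_I[of 1 x "m - 1" m] by simp
  have "I_coeff (x \<cdot> I_elt 0) 0 = 0" by (simp add: prd_C_right)
  with diag[of 0] diag[of m] True show ?thesis by simp
qed

lemma prd_I: "x \<cdot> I_elt m = 0"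
proof -
  have "hv_central (I_elt m \<cdot> y)" for y
    by (rule hv_centralI) (simp_all add: prd_commute[of "I_elt m"] product_coeff_L I_coeff_prd_I)
  then have "I_elt m \<cdot> x = 0" by (rule prd_eq_0_if_central_values)
  then show ?thesis by (simp add: prd_commute)
qed

lemma prd_prd: "x \<cdot> (y \<cdot> z) = 0"
proof (rule prd_eq_0_if_basis)
  fix a assume "a \<in> Poly_Mapping.keys (y \<cdot> z)"
  then show "x \<cdot> Poly_Mapping.single a 1 = 0"
    by (cases a) (auto simp: in_keys_iff product_coeff_L prd_I prd_C_right)
qed

lemma prd_trivial: "x \<cdot> y = 0"
proof (induction y rule: hv_perfect_induct)
  case (bracket y z)
  have "hv_bracket y z \<cdot> x = 0" by (simp add: prd_bracket_left prd_prd)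
  then show ?case by (simp add: prd_commute)
qed (simp add: prd_diff_right)

end

theorem theorem4p4:
  fixes prd :: "hv \<Rightarrow> hv \<Rightarrow> hv"
  assumes "comm_post_lie_structure hv_scale hv_bracket prd"
  shows "\<forall>x y. prd x y = 0"
proof -
  interpret hv_post_lie prd
    using assms by (rule hv_post_lie.intro)
  show ?thesis by (simp add: prd_trivial)
qed

end
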